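(* Let $X$ be a complex Hilbert space and let $T\in\mathcal{B}(X)$ be a power-bounded operator such that $\sigma(T)\cap\mathbb{T}=\{1\}$. Let $\alpha\geq1$. Then $\|R(\mathrm{e}^{\mathrm{i}\theta},T)\|=O(|\theta|^{-\alpha})$ as $\theta\to0$ if and only if $\|T^n(I-T)\|=O(n^{-1/\alpha})$ as $n\to\infty$.
   Context: $T$ is power-bounded if $\sup_{n\geq0}\|T^n\|<\infty$; $\mathbb{T}$ is the unit circle; $R(\lambda,T)=(\lambda-T)^{-1}$. *)

theory Defs
  imports "HOL-Analysis.Analysis" "HOL-Library.Landau_Symbols"
begin

class complex_inner = real_normed_vector +
  fixes scaleC :: "complex \<Rightarrow> 'a \<Rightarrow> 'a"
    and cinner :: "'a \<Rightarrow> 'a \<Rightarrow> complex"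
  assumes scaleC_add_right: "scaleC a (x + y) = scaleC a x + scaleC a y"
    and scaleC_add_left: "scaleC (a + b) x = scaleC a x + scaleC b x"
    and scaleC_scaleC: "scaleC a (scaleC b x) = scaleC (a * b) x"
    and scaleC_one: "scaleC 1 x = x"
    and scaleR_scaleC: "scaleR r x = scaleC (complex_of_real r) x"
    and cinner_commute: "cinner x y = cnj (cinner y x)"
    and cinner_add_left: "cinner (x + y) z = cinner x z + cinner y z"
    and cinner_scaleC_left: "cinner (scaleC c x) y = cnj c * cinner x y"
    and cinner_self_real: "Im (cinner x x) = 0"
    and cinner_self_nonneg: "0 \<le> Re (cinner x x)"
    and norm_eq_sqrt_cinner: "norm x = sqrt (Re (cinner x x))"

class chilbert_space = complex_inner + complete_space

definition bounded_clinear :: "('a::complex_inner \<Rightarrow> 'a) \<Rightarrow> bool" where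
  "bounded_clinear T \<longleftrightarrow> bounded_linear T \<and> (\<forall>c x. T (scaleC c x) = scaleC c (T x))"

definition shift_op :: "complex \<Rightarrow> ('a::complex_inner \<Rightarrow> 'a) \<Rightarrow> 'a \<Rightarrow> 'a" where
  "shift_op l T = (\<lambda>x. scaleC l x - T x)"

definition invertible_op :: "('a::complex_inner \<Rightarrow> 'a) \<Rightarrow> bool" where
  "invertible_op S \<longleftrightarrow> (\<exists>S'. bounded_clinear S' \<and> S' \<circ> S = id \<and> S \<circ> S' = id)"

definition op_spectrum :: "('a::complex_inner \<Rightarrow> 'a) \<Rightarrow> complex set" where
  "op_spectrum T = {l. \<not> invertible_op (shift_op l T)}"

definition resolvent :: "complex \<Rightarrow> ('a::complex_inner \<Rightarrow> 'a) \<Rightarrow> 'a \<Rightarrow> 'a" where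
  "resolvent l T = (THE S'. bounded_clinear S' \<and> S' \<circ> shift_op l T = id \<and> shift_op l T \<circ> S' = id)"

definition power_bounded :: "('a::complex_inner \<Rightarrow> 'a) \<Rightarrow> bool" where
  "power_bounded T \<longleftrightarrow> (\<exists>M. \<forall>n. onorm (T ^^ n) \<le> M)"

end

theory Submission
  imports Defs
begin

text \<open>Write \<open>A = (1/m) (I + T + \<dots> + T^(m-1))\<close>, let \<open>a \<mu>\<close> be the same average of the powers of a
  scalar \<open>\<mu>\<close>, and let \<open>B = (I - T) (I - A)^k\<close> with \<open>k \<ge> \<alpha> - 1\<close>.

  From resolvent growth to decay. For \<open>\<mu> \<noteq> 1\<close> on the unit circle,
  \<open>\<bar>1 - \<mu>\<bar> \<parallel>(a \<mu> - A) x\<parallel> \<le> 2 M \<parallel>(\<mu> - T) x\<parallel>\<close>; so, up to bounded terms, \<open>R(\<mu>,T) B\<close> is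
  \<open>(1 - \<mu>) (1 - a \<mu>)^k R(\<mu>,T)\<close>. As \<open>\<bar>1 - a \<mu>\<bar> \<le> min 2 (m \<bar>1 - \<mu>\<bar>)\<close>, the low frequencies are damped
  enough for \<open>R(\<mu>,T) B = O(m^(\<alpha>-1))\<close> uniformly in \<open>\<mu>\<close>. By Parseval's identity, the only place where
  the inner product is used, the same bound holds for the convolution operator that solves
  \<open>g(p+1) - T g(p) = B f(p)\<close>. Applied to an orbit weighted by a tent function this yields
  \<open>n \<parallel>T^n B\<parallel> = O(m^(\<alpha>-1))\<close>. Finally \<open>I - (I - A)^k\<close> is a multiple of \<open>A\<close> and
  \<open>(I - T) A = (I - T^m) / m\<close>, so \<open>T^n (I - T)\<close> differs from \<open>T^n B\<close> by \<open>O(1/m)\<close>; take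
  \<open>m\<close> of order \<open>n^(1/\<alpha>)\<close>.

  From decay to resolvent growth. In
  \<open>(1 - \<mu>) \<mu>^n x = T^n (I - T) x - T^n (\<mu> - T) x + (1 - \<mu>) (\<mu>^n - T^n) x\<close> the last two terms are
  bounded by \<open>M (1 + n \<bar>1 - \<mu>\<bar>) \<parallel>(\<mu> - T) x\<parallel>\<close>, and for \<open>n\<close> of order \<open>\<bar>1 - \<mu>\<bar>^(-\<alpha>)\<close> the first is
  absorbed by the left-hand side.\<close>

section \<open>Complex inner product spaces\<close>

interpretation cspace: vector_space "scaleC :: complex \<Rightarrow> 'a \<Rightarrow> 'a::complex_inner"
  by unfold_locales (auto simp: scaleC_add_right scaleC_add_left scaleC_scaleC scaleC_one)

lemma cinner_scaleC_right: "cinner x (scaleC c y) = c * cinner x y"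
  by (metis cinner_commute cinner_scaleC_left complex_cnj_cnj complex_cnj_mult)

lemma cinner_add_right: "cinner x (y + z) = cinner x y + cinner x z"
  by (metis cinner_commute cinner_add_left complex_cnj_add)

lemma cinner_zero_left: "cinner 0 x = 0"
  using cinner_add_left[of 0 0 x] by simp

lemma cinner_zero_right: "cinner x 0 = 0"
  using cinner_add_right[of x 0 0] by simp

lemma cinner_sum_left: "cinner (\<Sum>i\<in>A. f i) y = (\<Sum>i\<in>A. cinner (f i) y)"
  by (induction A rule: infinite_finite_induct) (auto simp: cinner_add_left cinner_zero_left)

lemma cinner_sum_right: "cinner y (\<Sum>i\<in>A. f i) = (\<Sum>i\<in>A. cinner y (f i))"
  by (induction A rule: infinite_finite_induct) (auto simp: cinner_add_right cinner_zero_right)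

lemma cinner_self: "cinner x x = complex_of_real ((norm x)\<^sup>2)"
  by (simp add: complex_eq_iff norm_eq_sqrt_cinner cinner_self_nonneg cinner_self_real)

lemma norm_scaleC: "norm (scaleC c x) = cmod c * norm x"
proof -
  have "complex_of_real ((norm (scaleC c x))\<^sup>2) = cinner (scaleC c x) (scaleC c x)"
    by (rule cinner_self[symmetric])
  also have "\<dots> = (cnj c * c) * cinner x x"
    by (simp add: cinner_scaleC_left cinner_scaleC_right)
  also have "\<dots> = complex_of_real ((cmod c * norm x)\<^sup>2)"
    by (simp add: cinner_self complex_norm_square[symmetric] mult.commute[of "cnj c"]
        power_mult_distrib)
  finally have "(norm (scaleC c x))\<^sup>2 = (cmod c * norm x)\<^sup>2"
    by (simp only: of_real_eq_iff)
  then show ?thesis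
    by (simp add: power2_eq_iff_nonneg)
qed

section \<open>A twisted discrete Fourier transform\<close>

text \<open>The frequencies are the \<open>N\<close>-th roots of \<open>-1\<close> rather than of \<open>1\<close>, so that the spectral point
  \<open>1\<close> is avoided.\<close>

definition freq :: "nat \<Rightarrow> nat \<Rightarrow> complex" where
  "freq N j = cis (pi / real N) * cis (2 * pi / real N) ^ j"

text \<open>The conjugate frequencies make a forward shift correspond to multiplication by the
  frequency itself. The sum is not normalised, hence the factor \<open>N\<close> in Parseval's
  identity.\<close>

definition dft :: "nat \<Rightarrow> (nat \<Rightarrow> 'a::complex_inner) \<Rightarrow> nat \<Rightarrow> 'a" where
  "dft N g j = (\<Sum>p<N. scaleC (cnj (freq N j) ^ p) (g p))"

lemma norm_freq: "cmod (freq N j) = 1"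
  by (simp add: freq_def norm_mult norm_power)

lemma freq_mult_cnj: "freq N j * cnj (freq N j) = 1"
  by (simp add: complex_norm_square[symmetric] norm_freq)

text \<open>The twist makes each frequency an \<open>N\<close>-th root of -1. The multiplier bound,
  which excludes \<open>\<mu> = 1\<close>, therefore applies at all of them.\<close>

lemma freq_neq_1:
  assumes "N > 0" shows "freq N j \<noteq> 1"
proof
  assume "freq N j = 1"
  then have "freq N j ^ N = 1" by simp
  moreover have "freq N j ^ N = cis (pi / real N) ^ N * (cis (2 * pi / real N) ^ N) ^ j"
    by (simp add: freq_def power_mult_distrib power_mult[symmetric] mult.commute)
  moreover have "cis (pi / real N) ^ N = -1" "cis (2 * pi / real N) ^ N = 1"
    using assms by (simp_all add: Complex.DeMoivre)
  ultimately show False by simp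
qed

text \<open>The twist contributes only a constant factor; what remains is a geometric sum over a
  nontrivial \<open>N\<close>-th root of unity.\<close>

lemma freq_orthogonal:
  assumes "p < N" "q < N" "p \<noteq> q"
  shows "(\<Sum>j<N. freq N j ^ p * cnj (freq N j) ^ q) = 0"
proof -
  define \<zeta> where "\<zeta> = cis (pi / real N)"
  define \<omega> where "\<omega> = cis (2 * pi / real N)"
  define \<eta> where "\<eta> = \<omega> ^ p * cnj \<omega> ^ q"
  have N: "N > 0" using assms by simp
  have unit: "\<omega> * cnj \<omega> = 1"
    by (simp add: \<omega>_def complex_norm_square[symmetric])
  have "\<omega> ^ N = 1" using N by (simp add: \<omega>_def Complex.DeMoivre)
  then have "\<eta> ^ N = 1"
    by (simp add: \<eta>_def power_mult_distrib power_mult[symmetric] mult.commute[of _ N])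
      (simp add: power_mult complex_cnj_power[symmetric])
  have "\<omega> ^ p \<noteq> \<omega> ^ q"
  proof -
    have "inj_on (\<lambda>k. cis (2 * pi * real k / real N)) {..<N}"
      using Complex.bij_betw_roots_unity[OF N] by (rule bij_betw_imp_inj_on)
    then have "cis (2 * pi * real p / real N) \<noteq> cis (2 * pi * real q / real N)"
      using assms by (auto dest: inj_onD)
    then show ?thesis by (simp add: \<omega>_def Complex.DeMoivre mult.commute)
  qed
  moreover have "\<eta> * \<omega> ^ q = \<omega> ^ p"
    by (simp add: \<eta>_def mult.assoc power_mult_distrib[symmetric] unit mult.commute[of "cnj \<omega>"])
  ultimately have "\<eta> \<noteq> 1" by auto
  have "(\<Sum>j<N. freq N j ^ p * cnj (freq N j) ^ q) = (\<Sum>j<N. \<zeta> ^ p * cnj \<zeta> ^ q * \<eta> ^ j)"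
    by (intro sum.cong refl)
      (simp add: freq_def \<zeta>_def \<omega>_def \<eta>_def power_mult_distrib power_mult[symmetric] mult_ac)
  also have "\<dots> = \<zeta> ^ p * cnj \<zeta> ^ q * (\<Sum>j<N. \<eta> ^ j)"
    by (simp add: sum_distrib_left)
  also have "\<dots> = 0"
    using \<open>\<eta> \<noteq> 1\<close> \<open>\<eta> ^ N = 1\<close> by (simp add: geometric_sum)
  finally show ?thesis .
qed

text \<open>Expanding the inner products gives a triple sum; moving the frequency sum innermost lets
  orthogonality keep only the diagonal.\<close>

lemma dft_parseval:
  "(\<Sum>j<N. (norm (dft N g j))\<^sup>2) = real N * (\<Sum>p<N. (norm (g p))\<^sup>2)"
proof -
  have ortho: "(\<Sum>j<N. freq N j ^ p * cnj (freq N j) ^ q) = (if q = p then of_nat N else 0)"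
    if "p < N" "q < N" for p q
    using that freq_orthogonal[of p N q]
    by (auto simp: power_mult_distrib[symmetric] freq_mult_cnj)
  have "complex_of_real (\<Sum>j<N. (norm (dft N g j))\<^sup>2) = (\<Sum>j<N. cinner (dft N g j) (dft N g j))"
    by (simp add: cinner_self)
  also have "\<dots> = (\<Sum>j<N. \<Sum>p<N. \<Sum>q<N.
      freq N j ^ p * cnj (freq N j) ^ q * cinner (g p) (g q))"
    unfolding dft_def cinner_sum_left
    by (simp add: cinner_sum_right cinner_scaleC_left cinner_scaleC_right sum_distrib_left mult_ac)
  also have "\<dots> = (\<Sum>p<N. \<Sum>j<N. \<Sum>q<N.
      freq N j ^ p * cnj (freq N j) ^ q * cinner (g p) (g q))"
    by (rule sum.swap)
  also have "\<dots> = (\<Sum>p<N. \<Sum>q<N. \<Sum>j<N.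
      freq N j ^ p * cnj (freq N j) ^ q * cinner (g p) (g q))"
    by (intro sum.cong refl sum.swap)
  also have "\<dots> = (\<Sum>p<N. \<Sum>q<N. (if q = p then of_nat N else 0) * cinner (g p) (g q))"
    by (intro sum.cong refl) (simp only: ortho lessThan_iff sum_distrib_right[symmetric])
  also have "\<dots> = (\<Sum>p<N. \<Sum>q<N. if q = p then of_nat N * cinner (g p) (g q) else 0)"
    by (intro sum.cong refl) auto
  also have "\<dots> = (\<Sum>p<N. of_nat N * cinner (g p) (g p))"
    by (intro sum.cong refl) (simp add: sum.delta)
  also have "\<dots> = complex_of_real (real N * (\<Sum>p<N. (norm (g p))\<^sup>2))"
    by (simp add: cinner_self sum_distrib_left)
  finally show ?thesis by (simp only: of_real_eq_iff)
qed

section \<open>Power-bounded operators\<close>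

lemma bounded_clinear_imp_bounded_linear: "bounded_clinear T \<Longrightarrow> bounded_linear T"
  by (simp add: bounded_clinear_def)

lemma bounded_linear_funpow:
  fixes T :: "'a::real_normed_vector \<Rightarrow> 'a"
  shows "bounded_linear T \<Longrightarrow> bounded_linear (T ^^ n)"
  by (induction n) (simp_all add: id_def o_def bounded_linear_ident bounded_linear_compose)

lemma power_bound_ge_1:
  assumes "bounded_clinear T" "power_bounded T"
  obtains M where "M \<ge> 1" "\<And>n x. norm ((T ^^ n) x) \<le> M * norm x"
proof -
  obtain M where M: "\<And>n. onorm (T ^^ n) \<le> M"
    using assms(2) unfolding power_bounded_def by blast
  have "norm ((T ^^ n) x) \<le> max 1 M * norm x" for n x
  proof -
    have "norm ((T ^^ n) x) \<le> onorm (T ^^ n) * norm x"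
      by (intro onorm bounded_linear_funpow bounded_clinear_imp_bounded_linear assms(1))
    also have "\<dots> \<le> max 1 M * norm x" using M[of n] by (intro mult_right_mono) auto
    finally show ?thesis .
  qed
  then show thesis using that[of "max 1 M"] by auto
qed

text \<open>By \<open>M_ge_1\<close>, \<open>1 + M\<close> is at least 2, the bound on the scalar
  symbol below, so powers of \<open>1 + M\<close> serve as common constants.\<close>

locale power_bounded_operator =
  fixes T :: "'a::complex_inner \<Rightarrow> 'a" and M :: real
  assumes clinear: "bounded_clinear T"
    and pow_bound: "norm ((T ^^ n) x) \<le> M * norm x"
    and M_ge_1: "1 \<le> M"
begin

lemma T_add: "T (x + y) = T x + T y"
  and T_scaleC: "T (scaleC c x) = scaleC c (T x)"
  using clinear by (auto simp: bounded_clinear_def linear_simps)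

text \<open>This algebra lets an operator pass through finite combinations of orbit elements, in
  particular through \<open>dft\<close>; norm bounds are supplied separately.\<close>

definition commuting :: "('a \<Rightarrow> 'a) \<Rightarrow> bool" where
  "commuting S \<longleftrightarrow> (\<forall>x y. S (x + y) = S x + S y) \<and> (\<forall>c x. S (scaleC c x) = scaleC c (S x))
     \<and> (\<forall>x. S (T x) = T (S x))"

lemma commutingD:
  assumes "commuting S"
  shows "S (x + y) = S x + S y" "S (scaleC c x) = scaleC c (S x)" "S (T x) = T (S x)"
    and "S 0 = 0" "S (- x) = - S x" "S (x - y) = S x - S y"
    and "S (\<Sum>i\<in>I. f i) = (\<Sum>i\<in>I. S (f i))" "S ((T ^^ n) x) = (T ^^ n) (S x)"
proof -
  show add: "S (x + y) = S x + S y" for x y using assms by (simp add: commuting_def)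
  show sc: "S (scaleC c x) = scaleC c (S x)" for c x using assms by (simp add: commuting_def)
  show com: "S (T x) = T (S x)" for x using assms by (simp add: commuting_def)
  show zero: "S 0 = 0" using add[of 0 0] by simp
  show minus: "S (- x) = - S x" for x
    using add[of x "- x"] zero by (simp add: eq_neg_iff_add_eq_0 add.commute)
  show "S (x - y) = S x - S y" using add[of x "- y"] minus by simp
  show "S (\<Sum>i\<in>I. f i) = (\<Sum>i\<in>I. S (f i))"
    by (induction I rule: infinite_finite_induct) (auto simp: add zero)
  show "S ((T ^^ n) x) = (T ^^ n) (S x)" by (induction n) (auto simp: com)
qed

lemma commuting_T: "commuting T"
  by (simp add: commuting_def T_add T_scaleC)

lemma commuting_funpow: "commuting S \<Longrightarrow> commuting (S ^^ k)"
  by (induction k) (auto simp: commuting_def)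

lemmas commuting_pow = commuting_funpow[OF commuting_T]
lemmas T_simps = commutingD(1,2,4-7)[OF commuting_T]
lemmas pow_simps = commutingD(1-7)[OF commuting_pow]

lemma commuting_compose: "commuting S \<Longrightarrow> commuting S' \<Longrightarrow> commuting (\<lambda>x. S (S' x))"
  by (simp add: commuting_def)

lemma commuting_diff: "commuting S \<Longrightarrow> commuting S' \<Longrightarrow> commuting (\<lambda>x. S x - S' x)"
  by (simp add: commuting_def cspace.scale_right_diff_distrib T_simps)

lemma commuting_ident: "commuting (\<lambda>x. x)"
  by (simp add: commuting_def)

section \<open>Cesaro averages of \<open>T\<close> and the scalar symbol of their complement\<close>

definition avg :: "nat \<Rightarrow> 'a \<Rightarrow> 'a" where
  "avg m x = scaleC (1 / of_nat m) (\<Sum>j<m. (T ^^ j) x)"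

definition dev :: "nat \<Rightarrow> 'a \<Rightarrow> 'a" where
  "dev m x = x - avg m x"


lemma commuting_avg: "commuting (avg m)"
  by (simp add: commuting_def avg_def pow_simps T_simps
      sum.distrib cspace.scale_right_distrib cspace.scale_sum_right mult.commute)

lemma commuting_dev: "commuting (dev m)"
  unfolding dev_def[abs_def] by (intro commuting_diff commuting_ident commuting_avg)

lemma norm_avg: "norm (avg m x) \<le> M * norm x"
proof (cases "m = 0")
  case True
  then show ?thesis using M_ge_1 by (simp add: avg_def)
next
  case False
  have "norm (\<Sum>j<m. (T ^^ j) x) \<le> (\<Sum>j<m. M * norm x)"
    by (intro sum_norm_le pow_bound)
  then show ?thesis
    using False by (simp add: avg_def norm_scaleC norm_divide field_simps)
qed

lemma norm_dev_pow: "norm ((dev m ^^ k) x) \<le> (1 + M) ^ k * norm x"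
proof (induction k)
  case (Suc k)
  have "norm ((dev m ^^ Suc k) x) \<le> norm ((dev m ^^ k) x) + norm (avg m ((dev m ^^ k) x))"
    by (simp add: dev_def norm_triangle_ineq4)
  also have "\<dots> \<le> (1 + M) * norm ((dev m ^^ k) x)"
    using norm_avg[of m "(dev m ^^ k) x"] by (simp add: algebra_simps)
  also have "\<dots> \<le> (1 + M) * ((1 + M) ^ k * norm x)"
    using Suc M_ge_1 by (intro mult_left_mono) auto
  finally show ?case by (simp add: mult.assoc)
qed simp

text \<open>Replacing \<open>T\<close> by \<mu> one factor at a time gives \<open>m\<close> terms,
  each a unimodular multiple of a power of \<open>T\<close> applied to
  \<open>\<mu> x - T x\<close>.\<close>

lemma norm_power_diff_le:
  assumes "cmod \<mu> = 1"
  shows "norm (scaleC (\<mu> ^ m) x - (T ^^ m) x) \<le> real m * (M * norm (scaleC \<mu> x - T x))"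
proof (induction m)
  case (Suc m)
  have "scaleC (\<mu> ^ Suc m) x - (T ^^ Suc m) x
      = scaleC \<mu> (scaleC (\<mu> ^ m) x - (T ^^ m) x) + (T ^^ m) (scaleC \<mu> x - T x)"
    by (simp add: cspace.scale_right_diff_distrib pow_simps)
  also have "norm \<dots> \<le> norm (scaleC (\<mu> ^ m) x - (T ^^ m) x) + M * norm (scaleC \<mu> x - T x)"
    by (rule order_trans[OF norm_triangle_ineq]) (simp add: norm_scaleC assms pow_bound)
  finally show ?case using Suc by (simp add: algebra_simps)
qed simp

text \<open>Writing \<open>1 - \<mu>\<close> as \<open>(I - T) - (\<mu> - T)\<close> in front of the
  powers of \<open>T\<close>, both geometric sums telescope and only multiples of
  \<open>\<mu> - T\<close> survive.\<close>

lemma sum_power_diff: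
  "scaleC (1 - \<mu>) (\<Sum>j<m. scaleC (\<mu> ^ j) x - (T ^^ j) x)
     = (\<Sum>j<m. (T ^^ j) (scaleC \<mu> x - T x)) - (scaleC (\<mu> ^ m) x - (T ^^ m) x)"
proof (induction m)
  case (Suc m)
  show ?case
    unfolding sum.lessThan_Suc cspace.scale_right_distrib Suc.IH
    by (simp add: cspace.scale_right_diff_distrib cspace.scale_left_diff_distrib pow_simps
        algebra_simps)
qed simp

text \<open>The scalar \<open>1 - a \<mu>\<close> of the overview: the value \<open>dev m\<close>
  takes on an eigenvector of \<open>T\<close> for \<mu>.\<close>

definition symb :: "nat \<Rightarrow> complex \<Rightarrow> complex" where
  "symb m \<mu> = 1 - (1 / of_nat m) * (\<Sum>j<m. \<mu> ^ j)"

text \<open>Bounding each \<open>\<mu>^j - T^j\<close> separately would lose a factor of order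
  \<open>m\<close>. Multiplied by \<open>1 - \<mu>\<close>, their sum has total size at most
  \<open>2 m M\<close> times the residual, and the average divides this by \<open>m\<close>.\<close>

lemma norm_dev_diff:
  assumes "cmod \<mu> = 1" "m > 0"
  shows "cmod (1 - \<mu>) * norm (dev m x - scaleC (symb m \<mu>) x) \<le> 2 * M * norm (scaleC \<mu> x - T x)"
proof -
  let ?y = "scaleC \<mu> x - T x"
  have eq: "dev m x - scaleC (symb m \<mu>) x
      = scaleC (1 / of_nat m) (\<Sum>j<m. scaleC (\<mu> ^ j) x - (T ^^ j) x)"
    unfolding dev_def avg_def symb_def cspace.scale_left_diff_distrib sum_subtractf
      cspace.scale_right_diff_distrib cspace.scale_sum_left[symmetric] cspace.scale_scale
    by simp
  have "cmod (1 - \<mu>) * norm (dev m x - scaleC (symb m \<mu>) x)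
      = (1 / real m) * norm (scaleC (1 - \<mu>) (\<Sum>j<m. scaleC (\<mu> ^ j) x - (T ^^ j) x))"
    unfolding eq by (simp add: norm_scaleC norm_divide)
  also have "\<dots> \<le> (1 / real m) * ((\<Sum>j<m. M * norm ?y) + real m * (M * norm ?y))"
    unfolding sum_power_diff
    by (intro mult_left_mono order_trans[OF norm_triangle_ineq4] add_mono sum_norm_le pow_bound
        norm_power_diff_le assms) auto
  also have "\<dots> = 2 * M * norm ?y" using assms by (simp add: field_simps)
  finally show ?thesis .
qed

lemma norm_symb_le_2:
  assumes "cmod \<mu> = 1" "m > 0"
  shows "cmod (symb m \<mu>) \<le> 2"
proof -
  have "cmod (\<Sum>j<m. \<mu> ^ j) \<le> (\<Sum>j<m. 1)"
    by (intro sum_norm_le) (simp add: norm_power assms)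
  then have "cmod ((1 / of_nat m) * (\<Sum>j<m. \<mu> ^ j)) \<le> 1"
    using assms by (simp add: norm_mult norm_divide)
  then show ?thesis
    unfolding symb_def using norm_triangle_ineq4[of 1 "(1 / of_nat m) * (\<Sum>j<m. \<mu> ^ j)"] by simp
qed

text \<open>The symbol is the mean of \<open>1 - \<mu>^j\<close> over \<open>j < m\<close>, so it
  vanishes linearly at 1; this is the damping of low frequencies.\<close>

lemma norm_symb_le:
  assumes "cmod \<mu> = 1" "m > 0"
  shows "cmod (symb m \<mu>) \<le> real m * cmod (1 - \<mu>)"
proof -
  have "symb m \<mu> = (1 / of_nat m) * (\<Sum>j<m. 1 ^ j - \<mu> ^ j)"
    using assms by (simp add: symb_def sum_subtractf field_simps)
  moreover have "cmod (\<Sum>j<m. 1 ^ j - \<mu> ^ j) \<le> (\<Sum>j<m. real m * cmod (1 - \<mu>))"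
  proof (intro sum_norm_le)
    fix j assume "j \<in> {..<m}"
    have "cmod (1 ^ j - \<mu> ^ j) \<le> real j * cmod (1 - \<mu>)"
      using assms by (intro norm_power_diff) auto
    also have "\<dots> \<le> real m * cmod (1 - \<mu>)"
      using \<open>j \<in> {..<m}\<close> by (intro mult_right_mono) auto
    finally show "cmod (1 ^ j - \<mu> ^ j) \<le> real m * cmod (1 - \<mu>)" .
  qed
  then have "1 / real m * cmod (\<Sum>j<m. 1 ^ j - \<mu> ^ j)
      \<le> 1 / real m * (\<Sum>j<m. real m * cmod (1 - \<mu>))"
    by (intro mult_left_mono) auto
  ultimately show ?thesis
    using assms by (simp add: norm_mult norm_divide)
qed

text \<open>Induction trades one factor \<open>dev m\<close> at a time for the scalar
  \<open>symb m \<mu>\<close>; each trade leaves an error controlled by the residual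
  \<open>\<mu> x - T x\<close>.\<close>

lemma norm_dev_pow_resolvent:
  assumes "cmod \<mu> = 1" "m > 0"
  shows "cmod (1 - \<mu>) * norm ((dev m ^^ k) x)
    \<le> cmod (1 - \<mu>) * cmod (symb m \<mu>) ^ k * norm x
      + 2 * M * real k * (1 + M) ^ k * norm (scaleC \<mu> x - T x)"
proof (induction k)
  case (Suc k)
  let ?v = "(dev m ^^ k) x" and ?y = "scaleC \<mu> x - T x"
  let ?\<tau> = "cmod (1 - \<mu>)" and ?w = "cmod (symb m \<mu>)"
  \<comment> \<open>Since \<open>dev m\<close> commutes with \<open>T\<close>, the residual of
    \<open>?v\<close> is a filtered residual of \<open>x\<close>.\<close>
  have y: "scaleC \<mu> ?v - T ?v = (dev m ^^ k) ?y"
    by (simp add: commutingD[OF commuting_funpow[OF commuting_dev]])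
  have w: "?w \<le> 1 + M" using norm_symb_le_2[OF assms] M_ge_1 by simp
  have pos: "0 \<le> 2 * M * real k * (1 + M) ^ k * norm ?y" "0 \<le> M * norm ?y * (1 + M) ^ k"
    using M_ge_1 by auto
  have "?\<tau> * norm (dev m ?v) \<le> ?\<tau> * (norm (dev m ?v - scaleC (symb m \<mu>) ?v) + ?w * norm ?v)"
    using norm_triangle_ineq[of "dev m ?v - scaleC (symb m \<mu>) ?v" "scaleC (symb m \<mu>) ?v"]
    by (intro mult_left_mono) (auto simp: norm_scaleC)
  also have "\<dots> \<le> 2 * M * norm ((dev m ^^ k) ?y) + ?w * (?\<tau> * norm ?v)"
    using norm_dev_diff[OF assms, of ?v] unfolding y by (simp add: algebra_simps)
  also have "\<dots> \<le> 2 * M * ((1 + M) ^ k * norm ?y)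
      + ?w * (?\<tau> * ?w ^ k * norm x + 2 * M * real k * (1 + M) ^ k * norm ?y)"
    using M_ge_1 by (intro add_mono mult_left_mono norm_dev_pow Suc) auto
  \<comment> \<open>The new error is enlarged by a factor \<open>1 + M\<close>, so that all
    \<open>k + 1\<close> errors take the same form.\<close>
  also have "\<dots> \<le> 2 * M * ((1 + M) ^ Suc k * norm ?y) + ?\<tau> * ?w ^ Suc k * norm x
      + (1 + M) * (2 * M * real k * (1 + M) ^ k * norm ?y)"
  proof -
    have "2 * M * ((1 + M) ^ k * norm ?y) \<le> 2 * M * ((1 + M) ^ Suc k * norm ?y)"
      using M_ge_1 by (intro mult_left_mono mult_right_mono power_increasing) auto
    moreover have "?w * (2 * M * real k * (1 + M) ^ k * norm ?y)
        \<le> (1 + M) * (2 * M * real k * (1 + M) ^ k * norm ?y)"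
      by (intro mult_right_mono w pos)
    ultimately show ?thesis by (simp add: algebra_simps)
  qed
  also have "\<dots> = ?\<tau> * ?w ^ Suc k * norm x
      + 2 * M * real (Suc k) * (1 + M) ^ Suc k * norm ?y"
    by (simp add: algebra_simps)
  finally show ?case by simp
qed simp

text \<open>Once \<open>m powr (\<alpha> - 1)\<close> is scaled out, the weight depends only on
  \<open>m\<close> times \<open>cmod (1 - \<mu>)\<close>. If this product is at least 1, the bound 2
  on the symbol is enough; otherwise its linear vanishing is.\<close>

lemma symb_weight_bound:
  assumes "cmod \<mu> = 1" "\<mu> \<noteq> 1" "m > 0" "\<alpha> \<ge> 1" "real k \<ge> \<alpha> - 1"
  shows "cmod (1 - \<mu>) * cmod (symb m \<mu>) ^ k * cmod (1 - \<mu>) powr (- \<alpha>)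
    \<le> 2 ^ k * real m powr (\<alpha> - 1)"
proof -
  let ?\<tau> = "cmod (1 - \<mu>)" and ?w = "cmod (symb m \<mu>)"
  have \<tau>: "?\<tau> > 0" using assms by simp
  have eq: "?\<tau> * ?w ^ k * ?\<tau> powr (- \<alpha>) = ?w ^ k * ?\<tau> powr (1 - \<alpha>)"
    using \<tau> by (simp add: powr_diff powr_minus field_simps)
  have split: "?\<tau> powr (1 - \<alpha>) = real m powr (\<alpha> - 1) * (real m * ?\<tau>) powr (1 - \<alpha>)"
    using \<tau> assms by (simp add: powr_mult powr_add[symmetric] mult.assoc[symmetric])
  have "?w ^ k * (real m * ?\<tau>) powr (1 - \<alpha>) \<le> 2 ^ k"
  proof (cases "real m * ?\<tau> \<ge> 1")
    case True
    then have "(real m * ?\<tau>) powr (1 - \<alpha>) \<le> 1"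
      using powr_mono[of "1 - \<alpha>" 0 "real m * ?\<tau>"] \<tau> assms by simp
    then have "?w ^ k * (real m * ?\<tau>) powr (1 - \<alpha>) \<le> 2 ^ k * 1"
      using norm_symb_le_2[OF assms(1,3)] by (intro mult_mono power_mono) auto
    then show ?thesis by simp
  next
    case False
    have mt: "real m * ?\<tau> > 0" using \<tau> assms by simp
    have "?w ^ k * (real m * ?\<tau>) powr (1 - \<alpha>) \<le> (real m * ?\<tau>) ^ k * (real m * ?\<tau>) powr (1 - \<alpha>)"
      using norm_symb_le[OF assms(1,3)] by (intro mult_right_mono power_mono) auto
    also have "\<dots> = (real m * ?\<tau>) powr (real k + (1 - \<alpha>))"
      using mt by (simp add: powr_add powr_realpow)
    \<comment> \<open>The condition on \<open>k\<close> makes the exponent nonnegative, and the base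
      is below 1.\<close>
    also have "\<dots> \<le> 1"
      using mt False assms by (intro powr_le1) auto
    also have "(1::real) \<le> 2 ^ k" by simp
    finally show ?thesis .
  qed
  then have "real m powr (\<alpha> - 1) * (?w ^ k * (real m * ?\<tau>) powr (1 - \<alpha>))
      \<le> real m powr (\<alpha> - 1) * 2 ^ k"
    by (intro mult_left_mono) auto
  then show ?thesis unfolding eq split by (simp add: mult_ac)
qed

section \<open>The filtered difference, \<open>B\<close> in the overview, and its resolvent
  bound\<close>

definition filt :: "nat \<Rightarrow> nat \<Rightarrow> 'a \<Rightarrow> 'a" where
  "filt m k x = (dev m ^^ k) x - T ((dev m ^^ k) x)"

lemma commuting_filt: "commuting (filt m k)"
  unfolding filt_def[abs_def]
  by (intro commuting_diff commuting_compose[OF commuting_T] commuting_funpow commuting_dev)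

text \<open>Split \<open>I - T\<close> as \<open>(\<mu> - T) + (1 - \<mu>)\<close>: the second
  summand supplies the factor \<open>cmod (1 - \<mu>)\<close> required by
  \<open>norm_dev_pow_resolvent\<close>, and the weight bound turns growth of order \<alpha> into a
  power of \<open>m\<close>.\<close>

lemma norm_filt_le:
  assumes \<mu>: "cmod \<mu> = 1" "\<mu> \<noteq> 1" and "m > 0" "\<alpha> \<ge> 1" "real k \<ge> \<alpha> - 1"
    and K: "norm x \<le> K * cmod (1 - \<mu>) powr (- \<alpha>) * norm (scaleC \<mu> x - T x)" "K \<ge> 0"
  shows "norm (filt m k x) \<le> (((1 + M) ^ k + 2 * M * real k * (1 + M) ^ k + K * 2 ^ k)
      * real m powr (\<alpha> - 1)) * norm (scaleC \<mu> x - T x)"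
proof -
  let ?v = "(dev m ^^ k) x" and ?y = "scaleC \<mu> x - T x"
  let ?\<tau> = "cmod (1 - \<mu>)" and ?w = "cmod (symb m \<mu>)"
  \<comment> \<open>This lets the bounded error terms be absorbed into the growth rate.\<close>
  have m1: "1 \<le> real m powr (\<alpha> - 1)" using assms by (intro ge_one_powr_ge_zero) auto
  have "filt m k x = (dev m ^^ k) ?y + scaleC (1 - \<mu>) ?v"
    by (simp add: filt_def commutingD[OF commuting_funpow[OF commuting_dev]]
        cspace.scale_left_diff_distrib)
  then have "norm (filt m k x) \<le> norm ((dev m ^^ k) ?y) + ?\<tau> * norm ?v"
    by (metis norm_triangle_ineq norm_scaleC)
  also have "\<dots> \<le> (1 + M) ^ k * norm ?y
      + (?\<tau> * ?w ^ k * norm x + 2 * M * real k * (1 + M) ^ k * norm ?y)"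
    by (intro add_mono norm_dev_pow norm_dev_pow_resolvent assms)
  also have "?\<tau> * ?w ^ k * norm x \<le> ?\<tau> * ?w ^ k * (K * ?\<tau> powr (- \<alpha>) * norm ?y)"
    by (intro mult_left_mono K) auto
  also have "\<dots> = (?\<tau> * ?w ^ k * ?\<tau> powr (- \<alpha>)) * (K * norm ?y)" by (simp add: mult_ac)
  also have "\<dots> \<le> (2 ^ k * real m powr (\<alpha> - 1)) * (K * norm ?y)"
    using K(2) by (intro mult_right_mono symb_weight_bound assms) auto
  finally have "norm (filt m k x) \<le> ((1 + M) ^ k + 2 * M * real k * (1 + M) ^ k) * norm ?y
      + K * 2 ^ k * real m powr (\<alpha> - 1) * norm ?y"
    by (simp add: algebra_simps)
  also have "((1 + M) ^ k + 2 * M * real k * (1 + M) ^ k) * norm ?y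
      \<le> (((1 + M) ^ k + 2 * M * real k * (1 + M) ^ k) * norm ?y) * real m powr (\<alpha> - 1)"
    using m1 M_ge_1 mult_left_mono[OF m1, of "((1 + M) ^ k + 2 * M * real k * (1 + M) ^ k) * norm ?y"]
    by simp
  finally show ?thesis by (simp add: algebra_simps)
qed

section \<open>The discrete multiplier theorem\<close>

lemma dft_commuting:
  assumes "commuting S"
  shows "dft N (\<lambda>p. S (g p)) j = S (dft N g j)"
  by (simp add: dft_def commutingD[OF assms])

text \<open>Vanishing at both ends removes the boundary terms of the index shift.\<close>

lemma dft_shift:
  assumes "g 0 = 0" "g N = 0"
  shows "dft N (\<lambda>p. g (Suc p)) j = scaleC (freq N j) (dft N g j)"
proof -
  let ?\<mu> = "freq N j"
  have "scaleC ?\<mu> (dft N g j) = (\<Sum>p<N. scaleC (?\<mu> * cnj ?\<mu> ^ p) (g p))"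
    by (simp add: dft_def cspace.scale_sum_right)
  also have "\<dots> = (\<Sum>p<Suc N. scaleC (?\<mu> * cnj ?\<mu> ^ p) (g p))"
    using assms by simp
  also have "\<dots> = (\<Sum>p<N. scaleC (?\<mu> * cnj ?\<mu> ^ Suc p) (g (Suc p)))"
    unfolding sum.lessThan_Suc_shift using assms by simp
  also have "\<dots> = (\<Sum>p<N. scaleC (cnj ?\<mu> ^ p) (g (Suc p)))"
    by (simp add: mult.assoc[symmetric] freq_mult_cnj)
  finally show ?thesis by (simp add: dft_def)
qed

text \<open>The transform turns \<open>g (Suc p) - T (g p)\<close> into \<open>\<mu> - T\<close>
  applied to the transform of \<open>g\<close>. The bound is used at each frequency, and the factors
  \<open>N\<close> from the two uses of Parseval's identity cancel.\<close>

lemma multiplier_l2_bound: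
  assumes S: "commuting S" and L: "L \<ge> 0"
    and bound: "\<And>\<mu> x. cmod \<mu> = 1 \<Longrightarrow> \<mu> \<noteq> 1 \<Longrightarrow> norm (S x) \<le> L * norm (scaleC \<mu> x - T x)"
    and g: "g 0 = 0" "g N = 0" and N: "N > 0"
  shows "(\<Sum>p<N. (norm (S (g p)))\<^sup>2) \<le> L\<^sup>2 * (\<Sum>p<N. (norm (g (Suc p) - T (g p)))\<^sup>2)"
proof -
  let ?f = "\<lambda>p. g (Suc p) - T (g p)"
  have f: "dft N ?f j = scaleC (freq N j) (dft N g j) - T (dft N g j)" for j
    using dft_shift[of g N j] dft_commuting[OF commuting_T, of N g j] g
    by (simp add: dft_def cspace.scale_right_diff_distrib sum_subtractf)
  have "real N * (\<Sum>p<N. (norm (S (g p)))\<^sup>2) = (\<Sum>j<N. (norm (S (dft N g j)))\<^sup>2)"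
    by (simp add: dft_parseval[symmetric] dft_commuting[OF S])
  also have "\<dots> \<le> (\<Sum>j<N. (L * norm (dft N ?f j))\<^sup>2)"
    unfolding f by (intro sum_mono power_mono bound norm_freq freq_neq_1 N) auto
  also have "\<dots> = real N * (L\<^sup>2 * (\<Sum>p<N. (norm (?f p))\<^sup>2))"
    by (simp add: power_mult_distrib sum_distrib_left[symmetric] dft_parseval)
  finally show ?thesis using N by (simp add: mult_le_cancel_left_pos)
qed

lemma cube_le_sum_squares: "real n ^ 3 \<le> 3 * (\<Sum>p\<le>n. (real p)\<^sup>2)"
proof (induction n)
  case (Suc n)
  have "real (Suc n) ^ 3 \<le> real n ^ 3 + 3 * (real (Suc n))\<^sup>2"
    by (simp add: power2_eq_square power3_eq_cube algebra_simps)
  then show ?case using Suc by (simp add: algebra_simps)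
qed simp

text \<open>The multiplier bound is applied to the orbit of \<open>x\<close> weighted by the tent
  \<open>min p (2n - p)\<close>, whose increments are \<open>\<plusminus>1\<close>.\<close>

lemma multiplier_orbit_bound:
  assumes S: "commuting S" and L: "L \<ge> 0"
    and bound: "\<And>\<mu> x. cmod \<mu> = 1 \<Longrightarrow> \<mu> \<noteq> 1 \<Longrightarrow> norm (S x) \<le> L * norm (scaleC \<mu> x - T x)"
    and n: "n > 0"
  shows "real n * norm ((T ^^ n) (S x)) \<le> 3 * M\<^sup>2 * L * norm x"
proof -
  define \<phi> where "\<phi> p = real (min p (2 * n - p))" for p
  define g where "g p = scaleC (complex_of_real (\<phi> p)) ((T ^^ p) x)" for p
  \<comment> \<open>\<open>T\<close> advances the orbit together with the index, so only the
    increment of the tent remains.\<close>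
  have step: "norm (g (Suc p) - T (g p)) \<le> M * norm x" if "p < 2 * n" for p
  proof -
    have "g (Suc p) - T (g p) = scaleC (complex_of_real (\<phi> (Suc p) - \<phi> p)) ((T ^^ Suc p) x)"
      by (simp add: g_def T_simps cspace.scale_left_diff_distrib)
    moreover have "\<bar>\<phi> (Suc p) - \<phi> p\<bar> \<le> 1"
      using that by (auto simp: \<phi>_def min_def of_nat_diff)
    ultimately have "norm (g (Suc p) - T (g p)) \<le> 1 * norm ((T ^^ Suc p) x)"
      unfolding norm_scaleC norm_of_real by (metis mult_right_mono norm_ge_zero norm_of_real norm_scaleC)
    then show ?thesis using pow_bound[of "Suc p" x] by simp
  qed
  \<comment> \<open>Power-boundedness compares time \<open>n\<close> with every earlier time
    \<open>p\<close>; the factor \<open>p\<close> is the height of the tent on its rising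
    half.\<close>
  have lower: "(norm ((T ^^ n) (S x)))\<^sup>2 * (real p)\<^sup>2 \<le> M\<^sup>2 * (norm (S (g p)))\<^sup>2" if "p \<le> n" for p
  proof -
    have "(T ^^ n) (S x) = (T ^^ (n - p)) (S ((T ^^ p) x))"
      using that by (metis commutingD(8)[OF S] comp_apply funpow_add le_add_diff_inverse2)
    then have "norm ((T ^^ n) (S x)) \<le> M * norm (S ((T ^^ p) x))"
      using pow_bound by simp
    then have "norm ((T ^^ n) (S x)) * real p \<le> M * norm (S ((T ^^ p) x)) * real p"
      by (rule mult_right_mono) simp
    also have "\<dots> = M * norm (S (g p))"
    proof -
      have "\<phi> p = real p" using that by (auto simp: \<phi>_def min_def)
      then show ?thesis by (simp add: g_def commutingD[OF S] norm_scaleC)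
    qed
    finally have "(norm ((T ^^ n) (S x)) * real p)\<^sup>2 \<le> (M * norm (S (g p)))\<^sup>2"
      by (rule power_mono) simp
    then show ?thesis by (simp add: power_mult_distrib)
  qed
  have "(norm ((T ^^ n) (S x)))\<^sup>2 * real n ^ 3 \<le> (norm ((T ^^ n) (S x)))\<^sup>2 * (3 * (\<Sum>p\<le>n. (real p)\<^sup>2))"
    by (intro mult_left_mono cube_le_sum_squares) simp
  also have "\<dots> = 3 * (\<Sum>p\<le>n. (norm ((T ^^ n) (S x)))\<^sup>2 * (real p)\<^sup>2)"
    by (simp add: sum_distrib_left mult_ac)
  also have "\<dots> \<le> 3 * (\<Sum>p\<le>n. M\<^sup>2 * (norm (S (g p)))\<^sup>2)"
    by (intro mult_left_mono sum_mono lower) auto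
  also have "\<dots> \<le> 3 * (\<Sum>p<2*n. M\<^sup>2 * (norm (S (g p)))\<^sup>2)"
    using n by (intro mult_left_mono sum_mono2) auto
  also have "\<dots> = 3 * M\<^sup>2 * (\<Sum>p<2*n. (norm (S (g p)))\<^sup>2)"
    by (simp add: sum_distrib_left mult.assoc)
  \<comment> \<open>The tent vanishes at 0 and at \<open>2 * n\<close>, the end conditions for
    \<open>N = 2 * n\<close>.\<close>
  also have "\<dots> \<le> 3 * M\<^sup>2 * (L\<^sup>2 * (\<Sum>p<2*n. (norm (g (Suc p) - T (g p)))\<^sup>2))"
    using n by (intro mult_left_mono multiplier_l2_bound S L bound) (auto simp: g_def \<phi>_def)
  also have "\<dots> \<le> 3 * M\<^sup>2 * (L\<^sup>2 * (\<Sum>p<2*n. (M * norm x)\<^sup>2))"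
    by (intro mult_left_mono sum_mono power_mono step) auto
  also have "\<dots> = 6 * real n * (M\<^sup>2 * L * norm x)\<^sup>2"
    by (simp add: power2_eq_square)
  finally have "real n * (real n * norm ((T ^^ n) (S x)))\<^sup>2 \<le> real n * (6 * (M\<^sup>2 * L * norm x)\<^sup>2)"
    by (simp add: power2_eq_square power3_eq_cube mult_ac)
  then have "(real n * norm ((T ^^ n) (S x)))\<^sup>2 \<le> 6 * (M\<^sup>2 * L * norm x)\<^sup>2"
    using n by (simp only: mult_le_cancel_left_pos of_nat_0_less_iff)
  also have "\<dots> \<le> (3 * M\<^sup>2 * L * norm x)\<^sup>2"
    by (simp add: power_mult_distrib mult_right_mono)
  finally show ?thesis
    by (rule power2_le_imp_le) (use L in auto)
qed

section \<open>Removing the filter and choosing its scale\<close>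

text \<open>The factors \<open>I - A\<close> are removed one at a time. Each removal costs
  \<open>(I - T) A = (I - T^m) / m\<close>, by telescoping, times bounded operators.\<close>

lemma norm_low_frequency:
  assumes "m > 0"
  shows "norm ((T ^^ n) (x - T x))
    \<le> norm ((T ^^ n) (filt m k x)) + 2 * M * real k * (1 + M) ^ k / real m * norm x"
proof (induction k)
  case 0
  then show ?case by (simp add: filt_def)
next
  case (Suc k)
  let ?v = "(dev m ^^ k) x"
  have tele: "(\<Sum>j<m. (T ^^ j) v) - (\<Sum>j<m. T ((T ^^ j) v)) = v - (T ^^ m) v" for v
    by (induction m) (auto simp: algebra_simps)
  have "filt m k x = filt m (Suc k) x + (avg m ?v - T (avg m ?v))"
    by (simp add: filt_def dev_def T_simps)
  also have "avg m ?v - T (avg m ?v) = scaleC (1 / of_nat m) (?v - (T ^^ m) ?v)"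
    by (simp only: avg_def T_simps cspace.scale_right_diff_distrib[symmetric] tele)
  finally have "(T ^^ n) (filt m k x) = (T ^^ n) (filt m (Suc k) x)
      + scaleC (1 / of_nat m) ((T ^^ n) ?v - (T ^^ (n + m)) ?v)"
    by (simp add: pow_simps funpow_add)
  then have "norm ((T ^^ n) (filt m k x)) \<le> norm ((T ^^ n) (filt m (Suc k) x))
      + 1 / real m * norm ((T ^^ n) ?v - (T ^^ (n + m)) ?v)"
    by (metis (no_types, lifting) norm_triangle_ineq norm_scaleC norm_divide norm_of_nat norm_one)
  also have "norm ((T ^^ n) ?v - (T ^^ (n + m)) ?v) \<le> M * norm ?v + M * norm ?v"
    by (intro order_trans[OF norm_triangle_ineq4] add_mono pow_bound)
  also have "M * norm ?v + M * norm ?v \<le> 2 * M * ((1 + M) ^ k * norm x)"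
    using M_ge_1 norm_dev_pow[of k m x] by simp
  finally have "norm ((T ^^ n) (filt m k x)) \<le> norm ((T ^^ n) (filt m (Suc k) x))
      + 2 * M * (1 + M) ^ k / real m * norm x"
    using assms by (simp add: divide_right_mono field_simps)
  with Suc have "norm ((T ^^ n) (x - T x)) \<le> norm ((T ^^ n) (filt m (Suc k) x))
      + 2 * M * real (Suc k) * (1 + M) ^ k / real m * norm x"
    by (simp add: field_simps add_divide_distrib)
  also have "\<dots> \<le> norm ((T ^^ n) (filt m (Suc k) x))
      + 2 * M * real (Suc k) * (1 + M) ^ Suc k / real m * norm x"
    using M_ge_1
    by (intro add_left_mono mult_right_mono divide_right_mono mult_left_mono power_increasing) auto
  finally show ?case .
qed

text \<open>The filtered part is of order \<open>m powr (\<alpha> - 1) / n\<close> and the discarded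
  part of order \<open>1 / m\<close>; they balance at \<open>n powr (- 1 / \<alpha>)\<close> when
  \<open>m\<close> is about \<open>n powr (1 / \<alpha>)\<close>.\<close>

lemma decay_of_resolvent_bound:
  assumes \<alpha>: "\<alpha> \<ge> 1" and K: "K \<ge> 0"
    and res: "\<And>\<mu> x. cmod \<mu> = 1 \<Longrightarrow> \<mu> \<noteq> 1 \<Longrightarrow>
      norm x \<le> K * cmod (1 - \<mu>) powr (- \<alpha>) * norm (scaleC \<mu> x - T x)"
  shows "\<exists>C\<ge>0. \<forall>n>0. \<forall>x. norm ((T ^^ n) (x - T x)) \<le> C * real n powr (- 1 / \<alpha>) * norm x"
proof -
  define k where "k = nat \<lceil>\<alpha> - 1\<rceil>"
  have k: "real k \<ge> \<alpha> - 1" unfolding k_def by (rule real_nat_ceiling_ge)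
  define A where "A = (1 + M) ^ k + 2 * M * real k * (1 + M) ^ k + K * 2 ^ k"
  define B where "B = 2 * M * real k * (1 + M) ^ k"
  have A: "A \<ge> 0" and B: "B \<ge> 0" using M_ge_1 K by (auto simp: A_def B_def)
  define C where "C = 3 * M\<^sup>2 * (A * 2 powr (\<alpha> - 1)) + B"
  have main: "norm ((T ^^ n) (x - T x)) \<le> C * real n powr (- 1 / \<alpha>) * norm x" if n: "n > 0" for n x
  proof -
    define s where "s = real n powr (1 / \<alpha>)"
    have s1: "s \<ge> 1" unfolding s_def using n \<alpha> by (intro ge_one_powr_ge_zero) auto
    have s_inv: "real n powr (- 1 / \<alpha>) = 1 / s" by (simp add: s_def powr_minus_divide)
    have s_pow: "s powr \<alpha> = real n" using n \<alpha> by (simp add: s_def powr_powr)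
    define m where "m = nat \<lceil>s\<rceil>"
    have ms: "real m \<ge> s" by (simp add: m_def real_nat_ceiling_ge)
    have m2: "real m \<le> 2 * s" using s1 unfolding m_def by linarith
    have m: "m > 0" using ms s1 by linarith
    define L where "L = A * real m powr (\<alpha> - 1)"
    have "L \<ge> 0" using A by (simp add: L_def)
    have "norm (filt m k z) \<le> L * norm (scaleC \<mu> z - T z)" if "cmod \<mu> = 1" "\<mu> \<noteq> 1" for \<mu> z
      unfolding L_def A_def by (rule norm_filt_le[OF that m \<alpha> k res[OF that] K])
    then have "real n * norm ((T ^^ n) (filt m k x)) \<le> 3 * M\<^sup>2 * L * norm x"
      using n \<open>L \<ge> 0\<close> by (intro multiplier_orbit_bound[OF commuting_filt]) auto
    then have 1: "norm ((T ^^ n) (filt m k x)) \<le> 3 * M\<^sup>2 * (L / real n) * norm x"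
      using n by (simp add: field_simps)
    have "L \<le> A * (2 * s) powr (\<alpha> - 1)"
      unfolding L_def using A \<alpha> m2 by (intro mult_left_mono powr_mono2) auto
    \<comment> \<open>As \<open>s powr \<alpha>\<close> is \<open>n\<close>, the power
      \<open>s powr (\<alpha> - 1)\<close> is \<open>n / s\<close>.\<close>
    also have "\<dots> = A * 2 powr (\<alpha> - 1) * (real n / s)"
      using s1 by (simp add: powr_mult powr_diff s_pow)
    finally have "L / real n \<le> A * 2 powr (\<alpha> - 1) / s"
      using n by (simp add: field_simps)
    then have "3 * M\<^sup>2 * (L / real n) * norm x \<le> 3 * M\<^sup>2 * (A * 2 powr (\<alpha> - 1) / s) * norm x"
      by (intro mult_right_mono mult_left_mono) auto
    moreover have "B / real m * norm x \<le> B / s * norm x"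
      using B ms s1 m by (intro mult_right_mono divide_left_mono) auto
    ultimately have "norm ((T ^^ n) (x - T x))
        \<le> 3 * M\<^sup>2 * (A * 2 powr (\<alpha> - 1) / s) * norm x + B / s * norm x"
      using norm_low_frequency[OF m, of n x k] 1 unfolding B_def[symmetric] by linarith
    also have "\<dots> = C * real n powr (- 1 / \<alpha>) * norm x"
      unfolding s_inv by (simp add: C_def add_divide_distrib distrib_right)
    finally show ?thesis .
  qed
  have "C \<ge> 0" using A B by (simp add: C_def)
  then show ?thesis by (intro exI[of _ C] conjI allI impI main)
qed

section \<open>From decay of the differences to a lower bound for \<open>\<mu> - T\<close>\<close>

lemma resolvent_bound_of_decay:
  assumes \<alpha>: "\<alpha> \<ge> 1" and C: "C > 0"
    and decay: "\<And>n x. n \<ge> n0 \<Longrightarrow>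
      norm ((T ^^ n) (x - T x)) \<le> C * real n powr (- 1 / \<alpha>) * norm x"
  shows "\<exists>K\<ge>0. \<forall>\<mu> x. cmod \<mu> = 1 \<longrightarrow> \<mu> \<noteq> 1 \<longrightarrow>
      norm x \<le> K * cmod (1 - \<mu>) powr (- \<alpha>) * norm (scaleC \<mu> x - T x)"
proof -
  \<comment> \<open>\<open>D\<close> bounds the time \<open>n\<close> chosen below: the first
    summand comes from the required decay, the second from the threshold \<open>n0\<close> and
    rounding up, rescaled by means of \<open>cmod (1 - \<mu>) \<le> 2\<close>.\<close>
  define D where "D = (2 * C) powr \<alpha> + (real n0 + 1) * 2 powr \<alpha>"
  define K where "K = 2 * M * 2 powr (\<alpha> - 1) + 2 * M * D"
  have main: "norm x \<le> K * cmod (1 - \<mu>) powr (- \<alpha>) * norm (scaleC \<mu> x - T x)"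
    if \<mu>: "cmod \<mu> = 1" "\<mu> \<noteq> 1" for \<mu> x
  proof -
    let ?\<tau> = "cmod (1 - \<mu>)" and ?y = "scaleC \<mu> x - T x"
    have \<tau>: "?\<tau> > 0" using \<mu> by simp
    have \<tau>2: "?\<tau> \<le> 2" using norm_triangle_ineq4[of 1 \<mu>] \<mu> by simp
    \<comment> \<open>Large enough for the decay factor at time \<open>n\<close> to be at most half
      of \<open>?\<tau>\<close>; adding \<open>n0\<close> reaches the range of the
      hypothesis.\<close>
    define n where "n = nat \<lceil>(2 * C / ?\<tau>) powr \<alpha>\<rceil> + n0"
    have n_ge: "real n \<ge> (2 * C / ?\<tau>) powr \<alpha>" and "n \<ge> n0"
      unfolding n_def by (auto intro: order_trans[OF real_nat_ceiling_ge])
    have pos: "(2 * C / ?\<tau>) powr \<alpha> > 0" using C \<tau> by simp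
    have "real n powr (- 1 / \<alpha>) \<le> ((2 * C / ?\<tau>) powr \<alpha>) powr (- 1 / \<alpha>)"
      using pos n_ge \<alpha> by (intro powr_mono2') auto
    also have "\<dots> = ?\<tau> / (2 * C)"
      using C \<tau> \<alpha> by (simp add: powr_powr powr_minus)
    finally have nd: "C * real n powr (- 1 / \<alpha>) \<le> ?\<tau> / 2"
      using C by (simp add: field_simps)
    have n_le: "real n \<le> D * ?\<tau> powr (- \<alpha>)"
    proof -
      have "real n \<le> (2 * C / ?\<tau>) powr \<alpha> + (real n0 + 1)"
        proof -
        have "real (nat \<lceil>(2 * C / ?\<tau>) powr \<alpha>\<rceil>) \<le> (2 * C / ?\<tau>) powr \<alpha> + 1"
          using pos by linarith
        then show ?thesis by (simp add: n_def)
      qed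
      also have "real n0 + 1 \<le> (real n0 + 1) * (2 powr \<alpha> * ?\<tau> powr (- \<alpha>))"
      proof -
        have "?\<tau> powr \<alpha> \<le> 2 powr \<alpha>" using \<tau> \<tau>2 \<alpha> by (intro powr_mono2) auto
        then have "1 \<le> 2 powr \<alpha> * ?\<tau> powr (- \<alpha>)"
          using \<tau> by (simp add: powr_minus field_simps)
        then show ?thesis by (simp add: mult_le_cancel_left1)
      qed
      also have "(2 * C / ?\<tau>) powr \<alpha> = (2 * C) powr \<alpha> * ?\<tau> powr (- \<alpha>)"
        using C \<tau> by (simp add: powr_divide powr_minus field_simps)
      finally show ?thesis by (simp add: D_def algebra_simps)
    qed
    have inv_le: "1 / ?\<tau> \<le> 2 powr (\<alpha> - 1) * ?\<tau> powr (- \<alpha>)"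
    proof -
      have "?\<tau> powr (\<alpha> - 1) \<le> 2 powr (\<alpha> - 1)" using \<tau> \<tau>2 \<alpha> by (intro powr_mono2) auto
      then show ?thesis using \<tau> by (simp add: powr_minus powr_diff field_simps)
    qed
    have eq: "scaleC ((1 - \<mu>) * \<mu> ^ n) x = (T ^^ n) (x - T x) - (T ^^ n) ?y
        + scaleC (1 - \<mu>) (scaleC (\<mu> ^ n) x - (T ^^ n) x)"
      by (simp add: pow_simps T_simps
          cspace.scale_left_diff_distrib cspace.scale_right_diff_distrib left_diff_distrib)
    have "?\<tau> * norm x = norm (scaleC ((1 - \<mu>) * \<mu> ^ n) x)"
      by (simp add: norm_scaleC norm_mult norm_power \<mu>)
    also have "\<dots> \<le> norm ((T ^^ n) (x - T x)) + norm ((T ^^ n) ?y)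
        + ?\<tau> * norm (scaleC (\<mu> ^ n) x - (T ^^ n) x)"
      unfolding eq norm_scaleC[symmetric]
      by (intro order_trans[OF norm_triangle_ineq] add_right_mono norm_triangle_ineq4)
    also have "\<dots> \<le> ?\<tau> / 2 * norm x + M * norm ?y + ?\<tau> * (real n * (M * norm ?y))"
      by (intro add_mono mult_left_mono pow_bound norm_power_diff_le \<mu>
          order_trans[OF decay[OF \<open>n \<ge> n0\<close>]] mult_right_mono nd) auto
    finally have *: "?\<tau> * norm x \<le> \<dots>" .
    \<comment> \<open>Absorbing the half of \<open>?\<tau> * norm x\<close> on the right doubles the
      other two terms.\<close>
    have "?\<tau> * norm x \<le> ?\<tau> * (2 * M * (1 / ?\<tau>) * norm ?y + 2 * M * real n * norm ?y)"
      (is "_ \<le> ?r")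
    proof -
      have "?r = 2 * (M * norm ?y) + 2 * (?\<tau> * (real n * (M * norm ?y)))"
        using \<tau> by (simp add: field_simps)
      with * show ?thesis by simp
    qed
    then have "norm x \<le> 2 * M * (1 / ?\<tau>) * norm ?y + 2 * M * real n * norm ?y"
      using \<tau> by (simp only: mult_le_cancel_left_pos)
    also have "\<dots> \<le> 2 * M * (2 powr (\<alpha> - 1) * ?\<tau> powr (- \<alpha>)) * norm ?y
        + 2 * M * (D * ?\<tau> powr (- \<alpha>)) * norm ?y"
      using M_ge_1 by (intro add_mono mult_right_mono mult_left_mono inv_le n_le) auto
    also have "\<dots> = K * ?\<tau> powr (- \<alpha>) * norm ?y"
      by (simp add: K_def algebra_simps)
    finally show ?thesis .
  qed
  have "K \<ge> 0" using M_ge_1 by (simp add: K_def D_def)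
  then show ?thesis by (intro exI[of _ K] conjI allI impI main)
qed

end

section \<open>Resolvents\<close>

text \<open>Two-sided inverses are unique, so off the spectrum the definite description in
  \<open>resolvent\<close> denotes the inverse.\<close>

lemma resolvent_inverse:
  assumes "l \<notin> op_spectrum T"
  shows "bounded_clinear (resolvent l T)"
    and "resolvent l T (scaleC l x - T x) = x"
    and "scaleC l (resolvent l T x) - T (resolvent l T x) = x"
proof -
  let ?P = "\<lambda>S. bounded_clinear S \<and> S \<circ> shift_op l T = id \<and> shift_op l T \<circ> S = id"
  have "\<exists>!S. ?P S"
  proof (rule ex_ex1I)
    show "\<exists>S. ?P S"
      using assms by (auto simp: op_spectrum_def invertible_op_def)
    show "S = S'" if "?P S" "?P S'" for S S'
      using that by (metis comp_assoc comp_id id_comp)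
  qed
  then have "?P (resolvent l T)"
    unfolding resolvent_def by (rule theI')
  then show "bounded_clinear (resolvent l T)"
    and "resolvent l T (scaleC l x - T x) = x"
    and "scaleC l (resolvent l T x) - T (resolvent l T x) = x"
    by (auto simp: shift_op_def fun_eq_iff)
qed

lemma norm_le_onorm_resolvent:
  assumes "l \<notin> op_spectrum T"
  shows "norm x \<le> onorm (resolvent l T) * norm (scaleC l x - T x)"
  using onorm[OF bounded_clinear_imp_bounded_linear[OF resolvent_inverse(1)[OF assms]],
      of "scaleC l x - T x"]
  by (simp add: resolvent_inverse(2)[OF assms])

lemma onorm_resolvent_nonneg:
  assumes "l \<notin> op_spectrum T" shows "0 \<le> onorm (resolvent l T)"
  by (intro onorm_pos_le bounded_clinear_imp_bounded_linear resolvent_inverse(1) assms)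

lemma onorm_resolvent_le:
  assumes "l \<notin> op_spectrum T" "K \<ge> 0" "\<And>x. norm x \<le> K * norm (scaleC l x - T x)"
  shows "onorm (resolvent l T) \<le> K"
  using assms(3)[of "resolvent l T y" for y] assms(2)
  by (intro onorm_bound) (simp_all add: resolvent_inverse(3)[OF assms(1)])

text \<open>Lower bounds persist nearby: moving \<open>l\<close> by less than
  \<open>1 / (2 * c l)\<close> costs a factor 2. By compactness finitely many such balls
  suffice.\<close>

lemma compact_resolvent_bound:
  assumes "compact S" "S \<inter> op_spectrum T = {}"
  shows "\<exists>K\<ge>0. \<forall>l\<in>S. \<forall>x. norm x \<le> K * norm (scaleC l x - T x)"
proof -
  \<comment> \<open>The added 1 keeps \<open>c l\<close>, and hence the radii below,
    positive.\<close>
  define c where "c l = onorm (resolvent l T) + 1" for l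
  have c_pos: "c l > 0" if "l \<in> S" for l
  proof -
    have "l \<notin> op_spectrum T" using that assms(2) by blast
    then show ?thesis using onorm_resolvent_nonneg[of l T] by (simp add: c_def)
  qed
  have c: "norm x \<le> c l * norm (scaleC l x - T x)" if "l \<in> S" for l x
  proof -
    have "l \<notin> op_spectrum T" using that assms(2) by blast
    from norm_le_onorm_resolvent[OF this, of x] show ?thesis
      by (simp add: c_def distrib_right add_increasing2)
  qed
  have near: "norm x \<le> 2 * c l * norm (scaleC \<mu> x - T x)"
    if l: "l \<in> S" and \<mu>: "\<mu> \<in> ball l (1 / (2 * c l))" for l \<mu> x
  proof -
    have "scaleC l x - T x = (scaleC \<mu> x - T x) + scaleC (l - \<mu>) x"
      by (simp add: cspace.scale_left_diff_distrib)
    then have "norm (scaleC l x - T x) \<le> norm (scaleC \<mu> x - T x) + cmod (l - \<mu>) * norm x"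
      by (metis norm_triangle_ineq norm_scaleC)
    also have "\<dots> \<le> norm (scaleC \<mu> x - T x) + 1 / (2 * c l) * norm x"
      using \<mu> by (intro add_left_mono mult_right_mono) (auto simp: dist_norm)
    finally have "c l * norm (scaleC l x - T x) \<le> c l * (norm (scaleC \<mu> x - T x) + 1 / (2 * c l) * norm x)"
      using c_pos[OF l] by (intro mult_left_mono) auto
    also have "\<dots> = c l * norm (scaleC \<mu> x - T x) + norm x / 2"
      using c_pos[OF l] by (simp add: field_simps)
    finally show ?thesis using c[OF l, of x] by simp
  qed
  have cover: "S \<subseteq> (\<Union>l\<in>S. ball l (1 / (2 * c l)))"
    using c_pos by auto
  obtain C where C: "C \<subseteq> S" "finite C" "S \<subseteq> (\<Union>l\<in>C. ball l (1 / (2 * c l)))"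
    by (rule compactE_image[OF assms(1) open_ball cover])
  have nonneg: "0 \<le> 2 * c l" if "l \<in> C" for l
    using c_pos that C(1) by (auto intro: less_imp_le)
  define K where "K = (\<Sum>l\<in>C. 2 * c l)"
  have "norm x \<le> K * norm (scaleC \<mu> x - T x)" if \<mu>: "\<mu> \<in> S" for \<mu> x
  proof -
    obtain l where l: "l \<in> C" "\<mu> \<in> ball l (1 / (2 * c l))" using C(3) \<mu> by blast
    then have "norm x \<le> 2 * c l * norm (scaleC \<mu> x - T x)" using near C(1) by blast
    also have "\<dots> \<le> K * norm (scaleC \<mu> x - T x)"
      unfolding K_def using l(1) C(2) nonneg by (intro mult_right_mono member_le_sum) auto
    finally show ?thesis .
  qed
  moreover have "K \<ge> 0" unfolding K_def using nonneg by (intro sum_nonneg) auto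
  ultimately show ?thesis by blast
qed

section \<open>Angles, chords and the resolvent bound on the whole circle\<close>

lemma norm_one_minus_cis: "cmod (1 - cis t) = 2 * \<bar>sin (t / 2)\<bar>"
  using dist_exp_i_1[of t] by (simp add: cis_conv_exp norm_minus_commute)

lemma norm_one_minus_cis_le: "cmod (1 - cis t) \<le> \<bar>t\<bar>"
  using abs_sin_x_le_abs_x[of "t / 2"] by (simp add: norm_one_minus_cis)

text \<open>The slope of \<open>sin (t / 2)\<close> at 0 is 1/2, so near 0 its ratio to
  \<open>t\<close> exceeds 1/4.\<close>

lemma eventually_norm_one_minus_cis_ge: "eventually (\<lambda>t. cmod (1 - cis t) \<ge> \<bar>t\<bar> / 2) (at 0)"
proof -
  have "((\<lambda>t::real. sin (t / 2) / t) \<longlongrightarrow> 1 / 2) (at 0)"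
  proof -
    have "((\<lambda>t::real. sin (t / 2)) has_field_derivative 1 / 2) (at 0)"
      by (auto intro!: derivative_eq_intros)
    then show ?thesis by (simp add: has_field_derivative_iff)
  qed
  then have "eventually (\<lambda>t::real. sin (t / 2) / t > 1 / 4) (at 0)"
    by (rule order_tendstoD) simp
  then show ?thesis
  proof (rule eventually_mono)
    fix t :: real
    assume *: "sin (t / 2) / t > 1 / 4"
    then have "1 / 4 \<le> \<bar>sin (t / 2) / t\<bar>" by linarith
    then have "1 / 4 \<le> \<bar>sin (t / 2)\<bar> / \<bar>t\<bar>" by (simp only: abs_divide)
    moreover have "t \<noteq> 0" using * by auto
    ultimately show "\<bar>t\<bar> / 2 \<le> cmod (1 - cis t)"
      by (simp add: norm_one_minus_cis field_simps)
  qed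
qed

lemma cis_neq_1:
  assumes "t \<noteq> 0" "\<bar>t\<bar> \<le> pi" shows "cis t \<noteq> 1"
proof
  assume "cis t = 1"
  then have "sin (t / 2) = 0" using norm_one_minus_cis[of t] by simp
  moreover have "- pi < t / 2" "t / 2 < pi" using assms pi_gt_zero by linarith+
  ultimately show False using assms sin_eq_0_pi[of "t / 2"] by simp
qed

text \<open>Small angles are governed by the growth hypothesis, since the chord is at most the
  angle; the remaining arc is compact and misses the spectrum.\<close>

lemma circle_resolvent_bound:
  fixes T :: "'a::complex_inner \<Rightarrow> 'a"
  assumes spec: "op_spectrum T \<inter> sphere 0 1 = {1}" and \<alpha>: "\<alpha> \<ge> 0"
    and bigo: "(\<lambda>\<theta>. onorm (resolvent (cis \<theta>) T)) \<in> O[at 0](\<lambda>\<theta>. \<bar>\<theta>\<bar> powr (- \<alpha>))"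
  shows "\<exists>K\<ge>0. \<forall>\<mu> x. cmod \<mu> = 1 \<longrightarrow> \<mu> \<noteq> 1 \<longrightarrow>
    norm x \<le> K * cmod (1 - \<mu>) powr (- \<alpha>) * norm (scaleC \<mu> x - T x)"
proof -
  from bigo obtain c where c: "c > 0"
    and ev: "eventually (\<lambda>\<theta>. norm (onorm (resolvent (cis \<theta>) T)) \<le> c * norm (\<bar>\<theta>\<bar> powr (- \<alpha>))) (at 0)"
    by (rule landau_o.bigE)
  from ev obtain d where d: "d > 0" and d_near: "\<forall>\<theta>. \<theta> \<noteq> 0 \<and> \<bar>\<theta>\<bar> < d \<longrightarrow>
      \<bar>onorm (resolvent (cis \<theta>) T)\<bar> \<le> c * \<bar>\<theta>\<bar> powr (- \<alpha>)"
    unfolding eventually_at by (auto simp: dist_norm)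
  have near: "onorm (resolvent (cis \<theta>) T) \<le> c * \<bar>\<theta>\<bar> powr (- \<alpha>)"
    if "\<theta> \<noteq> 0" "\<bar>\<theta>\<bar> < d" for \<theta>
    using d_near that abs_le_D1 by blast
  define S where "S = cis ` ({- pi..- d} \<union> {d..pi})"
  have "compact S"
    unfolding S_def by (intro compact_continuous_image continuous_intros compact_Un compact_Icc)
  moreover have "S \<inter> op_spectrum T = {}"
  proof -
    have "cis t \<noteq> 1" if "t \<in> {- pi..- d} \<union> {d..pi}" for t
      using that d by (intro cis_neq_1) auto
    then have "1 \<notin> S" by (auto simp: S_def)
    moreover have "S \<subseteq> sphere 0 1" by (auto simp: S_def)
    moreover have "l = 1" if "l \<in> op_spectrum T" "l \<in> sphere 0 1" for l
      using that spec IntI[of l] by blast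
    ultimately show ?thesis by blast
  qed
  ultimately have "\<exists>K\<ge>0. \<forall>l\<in>S. \<forall>x. norm x \<le> K * norm (scaleC l x - T x)"
    by (rule compact_resolvent_bound)
  then obtain K1 where K1: "K1 \<ge> 0"
    and far: "\<forall>l\<in>S. \<forall>x. norm x \<le> K1 * norm (scaleC l x - T x)"
    by blast
  have main: "norm x \<le> (c + K1 * 2 powr \<alpha>) * cmod (1 - \<mu>) powr (- \<alpha>) * norm (scaleC \<mu> x - T x)"
    if \<mu>: "cmod \<mu> = 1" "\<mu> \<noteq> 1" for \<mu> x
  proof -
    let ?\<tau> = "cmod (1 - \<mu>)" and ?y = "scaleC \<mu> x - T x"
    have \<tau>: "?\<tau> > 0" using \<mu> by simp
    define t where "t = Arg \<mu>"
    have "\<mu> \<noteq> 0" using \<mu> by auto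
    then have t: "cis t = \<mu>" using \<mu> cis_Arg[of \<mu>] by (simp add: t_def sgn_eq)
    have t_pi: "- pi < t" "t \<le> pi" using Arg_bounded[of \<mu>] by (auto simp: t_def)
    have "t \<noteq> 0" using t \<mu> by auto
    have "\<mu> \<in> sphere 0 1" using \<mu> by simp
    then have nonspec: "\<mu> \<notin> op_spectrum T" using spec \<mu>(2) by blast
    have "norm x \<le> (c * ?\<tau> powr (- \<alpha>)) * norm ?y \<or>
        norm x \<le> (K1 * 2 powr \<alpha> * ?\<tau> powr (- \<alpha>)) * norm ?y"
    proof (cases "\<bar>t\<bar> < d")
      case True
      have "onorm (resolvent \<mu> T) \<le> c * \<bar>t\<bar> powr (- \<alpha>)"
        using near[of t] True \<open>t \<noteq> 0\<close> t by simp
      also have "\<dots> \<le> c * ?\<tau> powr (- \<alpha>)"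
        using c \<tau> \<alpha> norm_one_minus_cis_le[of t] t by (intro mult_left_mono powr_mono2') auto
      finally have "onorm (resolvent \<mu> T) * norm ?y \<le> (c * ?\<tau> powr (- \<alpha>)) * norm ?y"
        by (rule mult_right_mono) simp
      then show ?thesis using norm_le_onorm_resolvent[OF nonspec, of x] by linarith
    next
      case False
      then have "\<mu> \<in> S" unfolding S_def t[symmetric] using t_pi by (intro imageI) auto
      then have "norm x \<le> K1 * norm ?y" using far by blast
      \<comment> \<open>A chord has length at most 2, so the constant bound on the far arc can be
        given the same shape as the near bound.\<close>
      also have "\<dots> \<le> (K1 * 2 powr \<alpha> * ?\<tau> powr (- \<alpha>)) * norm ?y"
      proof -
        have "?\<tau> \<le> 2" using norm_triangle_ineq4[of 1 \<mu>] \<mu> by simp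
        then have "?\<tau> powr \<alpha> \<le> 2 powr \<alpha>" using \<tau> \<alpha> by (intro powr_mono2) auto
        then have "1 \<le> 2 powr \<alpha> * ?\<tau> powr (- \<alpha>)"
          using \<tau> by (simp add: powr_minus field_simps)
        then have "K1 * 1 \<le> K1 * (2 powr \<alpha> * ?\<tau> powr (- \<alpha>))"
          using K1 by (rule mult_left_mono)
        then show ?thesis by (intro mult_right_mono) (auto simp: mult.assoc)
      qed
      finally show ?thesis by simp
    qed
    \<comment> \<open>Both bounds are nonnegative, so their sum covers either case.\<close>
    moreover have "0 \<le> (c * ?\<tau> powr (- \<alpha>)) * norm ?y"
      "0 \<le> (K1 * 2 powr \<alpha> * ?\<tau> powr (- \<alpha>)) * norm ?y"
      using c K1 by auto
    ultimately have "norm x \<le> (c * ?\<tau> powr (- \<alpha>)) * norm ?y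
        + (K1 * 2 powr \<alpha> * ?\<tau> powr (- \<alpha>)) * norm ?y"
      by linarith
    then show ?thesis by (simp only: distrib_right)
  qed
  have "c + K1 * 2 powr \<alpha> \<ge> 0" using c K1 by simp
  then show ?thesis by (intro exI[of _ "c + K1 * 2 powr \<alpha>"] conjI allI impI main)
qed

section \<open>Equivalence of resolvent growth at 1 and decay of \<open>T^n (I - T)\<close>\<close>

theorem theorem3p10:
  fixes T :: "'a::chilbert_space \<Rightarrow> 'a" and \<alpha> :: real
  assumes "bounded_clinear T"
    and "power_bounded T"
    and "op_spectrum T \<inter> sphere 0 1 = {1}"
    and "\<alpha> \<ge> 1"
  shows "(\<lambda>\<theta>. onorm (resolvent (cis \<theta>) T)) \<in> O[at 0](\<lambda>\<theta>. \<bar>\<theta>\<bar> powr (- \<alpha>))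
     \<longleftrightarrow> (\<lambda>n. onorm ((T ^^ n) \<circ> (\<lambda>x. x - T x))) \<in> O(\<lambda>n. real n powr (- 1 / \<alpha>))"
proof -
  obtain M where M: "M \<ge> 1" "\<And>n x. norm ((T ^^ n) x) \<le> M * norm x"
    using power_bound_ge_1[OF assms(1,2)] by blast
  interpret power_bounded_operator T M
    using assms(1) M by unfold_locales auto
  have bl: "bounded_linear ((T ^^ n) \<circ> (\<lambda>x. x - T x))" for n
    unfolding o_def using bounded_clinear_imp_bounded_linear[OF assms(1)]
    by (intro bounded_linear_compose[OF bounded_linear_funpow] bounded_linear_sub
        bounded_linear_ident)
  show ?thesis
  proof
    assume "(\<lambda>\<theta>. onorm (resolvent (cis \<theta>) T)) \<in> O[at 0](\<lambda>\<theta>. \<bar>\<theta>\<bar> powr (- \<alpha>))"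
    then have "\<exists>K\<ge>0. \<forall>\<mu> x. cmod \<mu> = 1 \<longrightarrow> \<mu> \<noteq> 1 \<longrightarrow>
        norm x \<le> K * cmod (1 - \<mu>) powr (- \<alpha>) * norm (scaleC \<mu> x - T x)"
      using assms(4) by (intro circle_resolvent_bound[OF assms(3)]) simp_all
    then obtain K where K: "K \<ge> 0" and res: "\<forall>\<mu> x. cmod \<mu> = 1 \<longrightarrow> \<mu> \<noteq> 1 \<longrightarrow>
        norm x \<le> K * cmod (1 - \<mu>) powr (- \<alpha>) * norm (scaleC \<mu> x - T x)"
      by blast
    obtain C where C: "C \<ge> 0" and
      decay: "\<forall>n>0. \<forall>x. norm ((T ^^ n) (x - T x)) \<le> C * real n powr (- 1 / \<alpha>) * norm x"
      using decay_of_resolvent_bound[OF assms(4) K res[rule_format]] by blast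
    show "(\<lambda>n. onorm ((T ^^ n) \<circ> (\<lambda>x. x - T x))) \<in> O(\<lambda>n. real n powr (- 1 / \<alpha>))"
    proof (rule bigoI)
      \<comment> \<open>Only positive \<open>n\<close> are considered: at 0 the comparison function
        has the value 0.\<close>
      show "\<forall>\<^sub>F n in sequentially. norm (onorm ((T ^^ n) \<circ> (\<lambda>x. x - T x)))
          \<le> C * norm (real n powr (- 1 / \<alpha>))"
        using eventually_gt_at_top[of 0]
      proof eventually_elim
        case (elim n)
        have "onorm ((T ^^ n) \<circ> (\<lambda>x. x - T x)) \<le> C * real n powr (- 1 / \<alpha>)"
          using C decay elim by (intro onorm_bound) auto
        then show ?case using onorm_pos_le[OF bl, of n] by simp
      qed
    qed
  next
    assume "(\<lambda>n. onorm ((T ^^ n) \<circ> (\<lambda>x. x - T x))) \<in> O(\<lambda>n. real n powr (- 1 / \<alpha>))"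
    then obtain C where C: "C > 0" and "\<forall>\<^sub>F n in sequentially.
        norm (onorm ((T ^^ n) \<circ> (\<lambda>x. x - T x))) \<le> C * norm (real n powr (- 1 / \<alpha>))"
      by (rule landau_o.bigE)
    then obtain n0 where "\<forall>n\<ge>n0.
        \<bar>onorm ((T ^^ n) \<circ> (\<lambda>x. x - T x))\<bar> \<le> C * real n powr (- 1 / \<alpha>)"
      by (auto simp: eventually_sequentially)
    then have n0: "onorm ((T ^^ n) \<circ> (\<lambda>x. x - T x)) \<le> C * real n powr (- 1 / \<alpha>)"
      if "n \<ge> n0" for n
      using that abs_le_D1 by blast
    have "norm ((T ^^ n) (x - T x)) \<le> C * real n powr (- 1 / \<alpha>) * norm x" if "n \<ge> n0" for n x
      using onorm[OF bl, of n x] mult_right_mono[OF n0[OF that], of "norm x"] by simp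
    from resolvent_bound_of_decay[OF assms(4) C this]
    obtain K where K: "K \<ge> 0" and res: "\<forall>\<mu> x. cmod \<mu> = 1 \<longrightarrow> \<mu> \<noteq> 1 \<longrightarrow>
        norm x \<le> K * cmod (1 - \<mu>) powr (- \<alpha>) * norm (scaleC \<mu> x - T x)"
      by blast
    show "(\<lambda>\<theta>. onorm (resolvent (cis \<theta>) T)) \<in> O[at 0](\<lambda>\<theta>. \<bar>\<theta>\<bar> powr (- \<alpha>))"
    proof (rule bigoI)
      \<comment> \<open>The factor \<open>2 powr \<alpha>\<close> pays for replacing the chord by
        half the angle.\<close>
      show "\<forall>\<^sub>F \<theta> in at 0. norm (onorm (resolvent (cis \<theta>) T))
          \<le> K * 2 powr \<alpha> * norm (\<bar>\<theta>\<bar> powr (- \<alpha>))"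
        using eventually_norm_one_minus_cis_ge eventually_neq_at_within[of 0]
      proof eventually_elim
        case (elim \<theta>)
        \<comment> \<open>The chord is at least half of a nonzero angle, hence positive.\<close>
        have neq: "cis \<theta> \<noteq> 1" using elim by auto
        moreover have "cis \<theta> \<in> sphere 0 1" by simp
        ultimately have nonspec: "cis \<theta> \<notin> op_spectrum T" using assms(3) by blast
        have "onorm (resolvent (cis \<theta>) T) \<le> K * cmod (1 - cis \<theta>) powr (- \<alpha>)"
          by (rule onorm_resolvent_le[OF nonspec _ res[rule_format, OF _ neq]]) (use K in simp_all)
        also have "\<dots> \<le> K * (\<bar>\<theta>\<bar> / 2) powr (- \<alpha>)"
          using K assms(4) elim by (intro mult_left_mono powr_mono2') auto
        also have "\<dots> = K * 2 powr \<alpha> * \<bar>\<theta>\<bar> powr (- \<alpha>)"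
          by (simp add: powr_divide powr_minus field_simps)
        finally show ?case using onorm_resolvent_nonneg[OF nonspec] by simp
      qed
    qed
  qed
qed

end
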